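(* Let $G$ be a connected $C_4$-free graph of order $n$, minimum degree $\delta$ and maximum degree $\Delta$. Let $\varepsilon_{\Delta}=\Delta\delta-2\lfloor \Delta/2\rfloor+1$ and $\varepsilon_{\delta}=\delta^2-2\lfloor \delta/2\rfloor+1$. Then \[ {\rm avec}(G)\leq \frac{15}{4}\,\frac{n-\varepsilon_{\Delta}+\varepsilon_{\delta}}{\varepsilon_{\delta}}\Big[1+\frac{\varepsilon_{\Delta}-\varepsilon_{\delta}}{3n}\Big]+\frac{37}{4}. \]
   Context: All graphs are finite and simple. A graph is $C_4$-free if it contains no 4-cycle as a (not necessarily induced) subgraph. For a connected graph $G$ and a vertex $v$, the eccentricity $e(v)$ is the largest distance from $v$ to a vertex of $G$. The average eccentricity is ${\rm avec}(G)=\frac{1}{|V(G)|}\sum_{v\in V(G)}e(v)$. *)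

theory Defs
  imports Complex_Main "Graph_Theory.Graph_Theory"
begin

(* A finite simple graph is an instance of the locale graph: a finite symmetric digraph without
   loops and parallel arcs, so every undirected edge is represented by two opposite arcs. The
   degree of a vertex is therefore its out_degree, and a cycle (in the sense of
   pre_digraph.cycle) of length at least 3 is a cycle of the undirected graph. *)

definition min_degree :: "('a, 'b) pre_digraph \<Rightarrow> nat" where
  "min_degree G = Min (out_degree G ` verts G)"

definition max_degree :: "('a, 'b) pre_digraph \<Rightarrow> nat" where
  "max_degree G = Max (out_degree G ` verts G)"

definition C4_free :: "('a, 'b) pre_digraph \<Rightarrow> bool" where
  "C4_free G \<longleftrightarrow> \<not> (\<exists>p. pre_digraph.cycle G p \<and> length p = 4)"

(* Shortest-path cost for unit arc weights. It takes the junk value 0 on unreachable pairs,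
   so it is only meaningful within a connected graph. *)
definition graph_dist :: "('a, 'b) pre_digraph \<Rightarrow> 'a \<Rightarrow> 'a \<Rightarrow> real" where
  "graph_dist G u v = real_of_ereal (wf_digraph.\<mu> G (\<lambda>_. 1) u v)"

definition eccentricity :: "('a, 'b) pre_digraph \<Rightarrow> 'a \<Rightarrow> real" where
  "eccentricity G v = Max (graph_dist G v ` verts G)"

definition avec :: "('a, 'b) pre_digraph \<Rightarrow> real" where
  "avec G = 1 / real (card (verts G)) * (\<Sum>v\<in>verts G. eccentricity G v)"

lemma (in fin_digraph) graph_dist_eq_length:
  assumes "u \<rightarrow>\<^sup>* v"
  obtains p where "apath u p v" and "graph_dist G u v = real (length p)"
    and "\<And>q. awalk u q v \<Longrightarrow> length p \<le> length q"
proof -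
  have cost: "awalk_cost (\<lambda>_. 1) p = real (length p)" for p
    by (induction p) auto
  obtain p where p: "apath u p v" "\<mu> (\<lambda>_. 1) u v = awalk_cost (\<lambda>_. 1) p"
    using min_cost_awalk[OF assms, of "\<lambda>_. 1"] by auto
  moreover have "length p \<le> length q" if "awalk u q v" for q
    using min_cost_le_walk_cost[OF that, of "\<lambda>_. 1"] p(2) cost by simp
  ultimately show thesis
    using that[of p] cost by (simp add: graph_dist_def)
qed

end

theory Submission
  imports Defs
begin

text \<open>
  In a C4-free graph the neighbourhood of a vertex \<open>v\<close> of degree \<open>k\<close> induces a matching and distinct
  neighbours of \<open>v\<close> have no common neighbour besides \<open>v\<close>, so at least
  \<open>k \<delta> - 2 \<lfloor>k / 2\<rfloor> + 1\<close> vertices lie within distance 2 of \<open>v\<close>. Take a maximal set \<open>A\<close> that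
  contains a vertex of degree \<open>\<Delta>\<close>, has pairwise distances at least 5, and is connected by hops of
  length at most 5. Every vertex is within distance 4 of \<open>A\<close>, so moving each vertex to a point of
  \<open>A\<close>, with priority for points within distance 2, changes eccentricities by at most \<open>4 + 4\<close> and
  gives each point of \<open>A\<close> a weight of at least \<open>\<epsilon>\<^sub>\<delta>\<close>, in one case \<open>\<epsilon>\<^sub>\<Delta>\<close>. This bounds the size
  of \<open>A\<close>, and the weighted eccentricities in \<open>A\<close> are bounded by 5 times those of a path, where all
  weight in excess of \<open>\<epsilon>\<^sub>\<delta>\<close> per vertex sits at an end.
\<close>

section \<open>Connectedness by cuts\<close>

text \<open>For symmetric \<open>E\<close> this is connectedness of the graph that \<open>E\<close>
  induces on \<open>S\<close>, with the empty set allowed. The cut form avoids paths and suits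
  arguments about maximal subsets.\<close>

definition cut_connected :: "('a \<Rightarrow> 'a \<Rightarrow> bool) \<Rightarrow> 'a set \<Rightarrow> bool" where
  "cut_connected E S \<longleftrightarrow> (\<forall>T. T \<subseteq> S \<longrightarrow> T \<noteq> {} \<longrightarrow> T \<noteq> S \<longrightarrow> (\<exists>t\<in>T. \<exists>s\<in>S - T. E t s))"

lemma cut_connectedD:
  assumes "cut_connected E S" "T \<subseteq> S" "T \<noteq> {}" "T \<noteq> S"
  obtains t s where "t \<in> T" "s \<in> S - T" "E t s"
  using assms unfolding cut_connected_def by blast

lemma cut_connected_mono:
  assumes "cut_connected E S" "\<And>x y. E x y \<Longrightarrow> E' x y"
  shows "cut_connected E' S"
  using assms unfolding cut_connected_def by metis

lemma cut_connected_singleton: "cut_connected E {x}"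
  unfolding cut_connected_def by blast

text \<open>A set \<open>T\<close> that splits \<open>S\<close> is left by an edge inside
  \<open>S\<close>. Otherwise \<open>T\<close> separates \<open>y\<close> from all of
  \<open>S\<close>, and the edge between \<open>t\<close> and \<open>y\<close> crosses; symmetry
  provides it in either direction.\<close>

lemma cut_connected_insert:
  assumes "symp E" "cut_connected E S" "t \<in> S" "E t y"
  shows "cut_connected E (insert y S)"
  unfolding cut_connected_def
proof (intro allI impI)
  fix T assume T: "T \<subseteq> insert y S" "T \<noteq> {}" "T \<noteq> insert y S"
  have yt: "E y t" using assms(1,4) by (simp add: sympD)
  show "\<exists>t\<in>T. \<exists>s\<in>insert y S - T. E t s"
  proof (cases "T \<inter> S = {} \<or> S \<subseteq> T")
    case True
    then consider "y \<in> T" "t \<notin> T" | "y \<notin> T" "t \<in> T"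
      using T assms(3) by blast
    then show ?thesis using assms(3,4) yt by cases auto
  next
    case False
    then obtain u s where "u \<in> T \<inter> S" "s \<in> S - T \<inter> S" "E u s"
      using cut_connectedD[OF assms(2), of "T \<inter> S"] by auto
    then show ?thesis by blast
  qed
qed

text \<open>\<open>S - {y}\<close> arises as a maximal connected proper subset containing \<open>r\<close>.\<close>
lemma cut_connected_remove:
  assumes "symp E" "finite S" "cut_connected E S" "r \<in> S" "S \<noteq> {r}"
  obtains y t where "y \<in> S" "y \<noteq> r" "cut_connected E (S - {y})" "t \<in> S - {y}" "E t y"
proof -
  define F where "F = {T. r \<in> T \<and> T \<subset> S \<and> cut_connected E T}"
  have "finite F" unfolding F_def using assms(2)
    by (simp add: finite_subset[of _ "Pow S"] subset_eq psubset_eq)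
  moreover have "{r} \<in> F" unfolding F_def using assms cut_connected_singleton by auto
  ultimately obtain T where T: "T \<in> F" and mx: "\<And>U. U \<in> F \<Longrightarrow> T \<subseteq> U \<Longrightarrow> U = T"
    using finite_has_maximal[of F] by blast
  from T have TS: "r \<in> T" "T \<subseteq> S" "T \<noteq> S" "cut_connected E T" by (auto simp: F_def)
  then obtain t y where ty: "t \<in> T" "y \<in> S - T" "E t y"
    using cut_connectedD[OF assms(3), of T] by blast
  have "cut_connected E (insert y T)"
    by (rule cut_connected_insert[OF assms(1) TS(4) ty(1,3)])
  then have "insert y T = S"
    using mx[of "insert y T"] ty(2) TS by (auto simp: F_def)
  then have "T = S - {y}" using ty(2) by blast
  then show thesis using that[of y t] ty TS by auto
qed

text \<open>The second removal is rooted at \<open>t\<close>, the vertex to which the first removed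
  vertex \<open>x\<close> attaches. Hence \<open>t\<close> survives, and both removed vertices keep
  a neighbour in the remainder.\<close>

lemma cut_connected_remove_two:
  assumes "symp E" "finite S" "cut_connected E S" "3 \<le> card S"
  obtains x y t u where "x \<in> S" "y \<in> S" "x \<noteq> y" "cut_connected E (S - {x, y})"
    "t \<in> S - {x, y}" "E t x" "u \<in> S - {x, y}" "E u y"
proof -
  obtain r where r: "r \<in> S" "S \<noteq> {r}"
    using assms(4)
    by (metis card.empty card_1_singleton_iff equals0I not_numeral_le_zero numeral_le_one_iff
        One_nat_def semiring_norm(70))
  obtain x t where x: "x \<in> S" "cut_connected E (S - {x})" "t \<in> S - {x}" "E t x"
    using cut_connected_remove[OF assms(1-3) r] by metis
  have "card (S - {x}) \<ge> 2" using assms(4) x(1) by simp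
  then have "S - {x} \<noteq> {t}"
    by (metis card_1_singleton_iff One_nat_def not_numeral_le_zero numeral_le_one_iff
        semiring_norm(69))
  then obtain y u where y: "y \<in> S - {x}" "y \<noteq> t" "cut_connected E (S - {x} - {y})"
      "u \<in> S - {x} - {y}" "E u y"
    using cut_connected_remove[OF assms(1) _ x(2,3)] assms(2) by (metis finite_Diff)
  moreover have "S - {x} - {y} = S - {x, y}" by blast
  ultimately show thesis using that[of x y t u] x by auto
qed

section \<open>Eccentricities in finite pseudometric spaces\<close>

locale finite_pseudometric =
  fixes V :: "'a set" and d :: "'a \<Rightarrow> 'a \<Rightarrow> real"
  assumes finite_carrier: "finite V"
    and d_self: "x \<in> V \<Longrightarrow> d x x = 0"
    and d_sym: "d x y = d y x"
    and d_triangle: "x \<in> V \<Longrightarrow> y \<in> V \<Longrightarrow> z \<in> V \<Longrightarrow> d x z \<le> d x y + d y z"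
begin

text \<open>Distances remain those of the ambient space, even for a proper subset \<open>S\<close>,
  and \<open>v\<close> may lie outside \<open>S\<close>.\<close>

definition ecc :: "'a set \<Rightarrow> 'a \<Rightarrow> real" where
  "ecc S v = Max (d v ` S)"

lemma symp_near: "symp (\<lambda>x y. d x y \<le> L)"
  by (simp add: symp_def d_sym)

lemma d_le_ecc: "S \<subseteq> V \<Longrightarrow> s \<in> S \<Longrightarrow> d v s \<le> ecc S v"
  unfolding ecc_def using finite_carrier by (simp add: finite_subset)

lemma ecc_leI: "S \<subseteq> V \<Longrightarrow> S \<noteq> {} \<Longrightarrow> (\<And>s. s \<in> S \<Longrightarrow> d v s \<le> b) \<Longrightarrow> ecc S v \<le> b"
  unfolding ecc_def using finite_carrier by (simp add: finite_subset)

lemma ecc_dense_subset: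
  assumes "S \<subseteq> V" "T \<subseteq> S" "S \<noteq> {}" "v \<in> V" "\<And>s. s \<in> S \<Longrightarrow> \<exists>t\<in>T. d t s \<le> L"
  shows "ecc S v \<le> ecc T v + L"
proof (rule ecc_leI)
  fix s assume s: "s \<in> S"
  then obtain t where t: "t \<in> T" "d t s \<le> L" using assms(5) by blast
  have "d v s \<le> d v t + d t s" using d_triangle assms s t by blast
  also have "\<dots> \<le> ecc T v + L" using d_le_ecc[of T t v] assms t by fastforce
  finally show "d v s \<le> ecc T v + L" .
qed (use assms in auto)

text \<open>Deleting non-cut vertices other than \<open>v\<close> one at a time lowers the
  eccentricity of \<open>v\<close> by at most \<open>L\<close> each, until only \<open>v\<close> is
  left.\<close>

lemma ecc_le_card:
  assumes "S \<subseteq> V" "0 \<le> L" "cut_connected (\<lambda>x y. d x y \<le> L) S" "v \<in> S"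
  shows "ecc S v \<le> L * (real (card S) - 1)"
  using assms
proof (induction "card S" arbitrary: S)
  case 0
  then show ?case using finite_carrier by (metis card_0_eq empty_iff finite_subset)
next
  case (Suc k)
  have fin: "finite S" using Suc.prems(1) finite_carrier finite_subset by blast
  show ?case
  proof (cases "S = {v}")
    case True
    then show ?thesis using d_self Suc.prems by (simp add: ecc_def)
  next
    case False
    then obtain y t where y: "y \<in> S" "y \<noteq> v" "cut_connected (\<lambda>x y. d x y \<le> L) (S - {y})"
        "t \<in> S - {y}" "d t y \<le> L"
      using cut_connected_remove[OF symp_near fin Suc.prems(3,4)] by metis
    have k: "card (S - {y}) = k" using Suc.hyps(2) y(1) by simp
    have IH: "ecc (S - {y}) v \<le> L * (real k - 1)"
      using Suc.hyps(1)[of "S - {y}"] Suc.prems y k by auto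
    have "ecc S v \<le> ecc (S - {y}) v + L"
    proof (rule ecc_dense_subset)
      fix s assume "s \<in> S"
      show "\<exists>t\<in>S - {y}. d t s \<le> L"
      proof (cases "s = y")
        case True then show ?thesis using y by blast
      next
        case False
        moreover have "d s s \<le> L" using \<open>s \<in> S\<close> Suc.prems(1,2) d_self[of s] by auto
        ultimately show ?thesis using \<open>s \<in> S\<close> by blast
      qed
    qed (use Suc.prems in auto)
    with IH show ?thesis unfolding Suc.hyps(2)[symmetric] by (simp add: algebra_simps)
  qed
qed

text \<open>Removing two non-cut vertices lowers every other eccentricity by at most \<open>L\<close>, which accounts
  for the growth \<open>3/2 * L * card S\<close> per vertex of the bound. Equality holds for
  paths of even order with steps of length \<open>L\<close>.\<close>
lemma sum_ecc_le:
  assumes "S \<subseteq> V" "0 \<le> L" "cut_connected (\<lambda>x y. d x y \<le> L) S"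
  shows "(\<Sum>v\<in>S. ecc S v) \<le> L * (3 * (real (card S))\<^sup>2 - 2 * real (card S)) / 4"
  using assms
proof (induction "card S" arbitrary: S rule: less_induct)
  case less
  have fin: "finite S" using less.prems(1) finite_carrier finite_subset by blast
  have le: "ecc S v \<le> L * (real (card S) - 1)" if "v \<in> S" for v
    using ecc_le_card[OF less.prems that] .
  consider "card S = 0" | "card S = 1" | "card S = 2" | "3 \<le> card S" by linarith
  then show ?case
  proof cases
    case 1 then show ?thesis using fin by simp
  next
    case 4
    obtain x y t u where xy: "x \<in> S" "y \<in> S" "x \<noteq> y"
        "cut_connected (\<lambda>x y. d x y \<le> L) (S - {x, y})"
        "t \<in> S - {x, y}" "d t x \<le> L" "u \<in> S - {x, y}" "d u y \<le> L"
      using cut_connected_remove_two[OF symp_near fin less.prems(3) 4] by metis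
    define T where "T = S - {x, y}"
    have cT: "card T = card S - 2" unfolding T_def using xy(1-3) fin by simp
    then have rT: "real (card T) = real (card S) - 2" using 4 by linarith
    have S: "S = insert x (insert y T)" "x \<notin> insert y T" "y \<notin> T" "finite T"
      unfolding T_def using xy(1-3) fin by auto
    have IH: "(\<Sum>v\<in>T. ecc T v) \<le> L * (3 * (real (card T))\<^sup>2 - 2 * real (card T)) / 4"
      using less.hyps[of T] less.prems cT 4 xy(4) by (auto simp: T_def)
    have step: "ecc S v \<le> ecc T v + L" if "v \<in> T" for v
    proof (rule ecc_dense_subset)
      fix s assume "s \<in> S"
      then consider "s = x" | "s = y" | "s \<in> T" using S by blast
      then show "\<exists>t\<in>T. d t s \<le> L"
      proof cases
        case 3
        then show ?thesis using \<open>s \<in> S\<close> less.prems(1,2) d_self[of s] by (intro bexI[of _ s]) auto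
      qed (use xy T_def in blast)+
    qed (use less.prems S that in auto)
    have "(\<Sum>v\<in>S. ecc S v) = ecc S x + ecc S y + (\<Sum>v\<in>T. ecc S v)"
      using S by (subst S(1)) (simp add: add.assoc)
    also have "(\<Sum>v\<in>T. ecc S v) \<le> (\<Sum>v\<in>T. ecc T v + L)"
      by (rule sum_mono) (rule step)
    also have "\<dots> = (\<Sum>v\<in>T. ecc T v) + real (card T) * L"
      by (simp add: sum.distrib)
    finally have "(\<Sum>v\<in>S. ecc S v) \<le> L * (real (card S) - 1) + L * (real (card S) - 1)
       + (L * (3 * (real (card T))\<^sup>2 - 2 * real (card T)) / 4 + real (card T) * L)"
      using le[OF xy(1)] le[OF xy(2)] IH by linarith
    \<comment> \<open>With \<open>m = card S\<close>, the increment
      \<open>2 * L * (m - 1) + L * (m - 2) = L * (3 * m - 4)\<close> is exactly the difference of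
      the claimed bounds at \<open>m\<close> and \<open>m - 2\<close>.\<close>
    also have "\<dots> \<le> L * (3 * (real (card S))\<^sup>2 - 2 * real (card S)) / 4"
      unfolding rT by (simp add: power2_eq_square field_simps)
    finally show ?thesis .
  next
    case 2
    then show ?thesis using sum_bounded_above[of S "ecc S", OF le] less.prems(2) by simp
  next
    case 3
    then show ?thesis using sum_bounded_above[of S "ecc S", OF le] by simp
  qed
qed

section \<open>Packings and the weighted eccentricity bound\<close>

lemma ex_packing:
  assumes conn: "cut_connected (\<lambda>x y. d x y \<le> 1) V" and "v\<^sub>1 \<in> V" "0 \<le> r"
  obtains A where "A \<subseteq> V" "v\<^sub>1 \<in> A" "cut_connected (\<lambda>x y. d x y \<le> r + 1) A"
    "\<And>x y. x \<in> A \<Longrightarrow> y \<in> A \<Longrightarrow> x \<noteq> y \<Longrightarrow> r < d x y" "\<And>v. v \<in> V \<Longrightarrow> \<exists>a\<in>A. d a v \<le> r"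
proof -
  define F where "F = {A. A \<subseteq> V \<and> v\<^sub>1 \<in> A \<and> cut_connected (\<lambda>x y. d x y \<le> r + 1) A \<and>
    (\<forall>x\<in>A. \<forall>y\<in>A. x \<noteq> y \<longrightarrow> r < d x y)}"
  have "finite F" unfolding F_def using finite_carrier by (simp add: finite_subset[of _ "Pow V"] subset_eq)
  moreover have "{v\<^sub>1} \<in> F" unfolding F_def using assms cut_connected_singleton by auto
  ultimately obtain A where A: "A \<in> F" and mx: "\<And>U. U \<in> F \<Longrightarrow> A \<subseteq> U \<Longrightarrow> U = A"
    using finite_has_maximal[of F] by blast
  have AV: "A \<subseteq> V" "v\<^sub>1 \<in> A" and cA: "cut_connected (\<lambda>x y. d x y \<le> r + 1) A"
    and far: "\<And>x y. x \<in> A \<Longrightarrow> y \<in> A \<Longrightarrow> x \<noteq> y \<Longrightarrow> r < d x y"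
    using A unfolding F_def by auto
  define U where "U = {v \<in> V. \<exists>a\<in>A. d a v \<le> r}"
  have "U = V"
  \<comment> \<open>An uncovered \<open>w\<close> one step from the covered set \<open>U\<close> is
    more than \<open>r\<close> from every point of \<open>A\<close>, yet within \<open>r + 1\<close>
    of one of them. Adding it to \<open>A\<close> contradicts maximality.\<close>
  proof (rule ccontr)
    assume "U \<noteq> V"
    moreover have "v\<^sub>1 \<in> U" unfolding U_def using AV(2) assms(2,3) d_self[of v\<^sub>1] by force
    ultimately obtain u w where uw: "u \<in> U" "w \<in> V - U" "d u w \<le> 1"
      using cut_connectedD[OF conn, of U] unfolding U_def by blast
    then obtain a where a: "a \<in> A" "d a u \<le> r" unfolding U_def by blast
    have aw: "d a w \<le> r + 1"
      using d_triangle[of a u w] uw a AV unfolding U_def by fastforce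
    have w: "r < d b w" if "b \<in> A" for b using that uw(2) unfolding U_def by force
    have "cut_connected (\<lambda>x y. d x y \<le> r + 1) (insert w A)"
      by (rule cut_connected_insert[OF symp_near cA a(1) aw])
    moreover have "r < d x y" if "x \<in> insert w A" "y \<in> insert w A" "x \<noteq> y" for x y
      using that far w d_sym by (metis insertE)
    ultimately have "insert w A \<in> F" unfolding F_def using AV uw by blast
    then have "insert w A = A" using mx by blast
    then have "w \<in> A" by blast
    then show False using w[of w] d_self[of w] uw assms(3) by auto
  qed
  then show thesis using that[of A] AV cA far unfolding U_def by blast
qed

text \<open>\<open>N\<close> is the possibly fractional number of weights \<open>\<epsilon>\<close>
  that make up \<open>card V\<close> once the surplus \<open>D\<close> at \<open>v\<^sub>1\<close>
  is set aside. The term \<open>5 / 4 * N * D\<close> becomes the bracketed correction of the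
  theorem after division by \<open>card V\<close>.\<close>

lemma sum_ecc_le_ball:
  fixes \<epsilon> D N :: real
  assumes conn: "cut_connected (\<lambda>x y. d x y \<le> 1) V" and "v\<^sub>1 \<in> V" "0 < \<epsilon>" "0 \<le> D"
    and ball: "\<And>v. v \<in> V \<Longrightarrow> \<epsilon> \<le> card {x \<in> V. d v x \<le> 2}"
    and ball1: "\<epsilon> + D \<le> card {x \<in> V. d v\<^sub>1 x \<le> 2}"
    and N: "real (card V) = N * \<epsilon> + D"
  shows "(\<Sum>v\<in>V. ecc V v) \<le> card V * (15 / 4 * N + 37 / 4) + 5 / 4 * N * D"
proof -
  obtain A where A: "A \<subseteq> V" "v\<^sub>1 \<in> A" "cut_connected (\<lambda>x y. d x y \<le> 5) A"
    and far: "\<And>x y. x \<in> A \<Longrightarrow> y \<in> A \<Longrightarrow> x \<noteq> y \<Longrightarrow> 4 < d x y"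
    and dense: "\<And>v. v \<in> V \<Longrightarrow> \<exists>a\<in>A. d a v \<le> 4"
    using ex_packing[OF conn \<open>v\<^sub>1 \<in> V\<close>, of 4] by auto
  have finA: "finite A" using A finite_carrier finite_subset by blast
  \<comment> \<open>Points of \<open>A\<close> are more than 4 apart, so the first choice is unique when it exists.\<close>
  define \<phi> where "\<phi> v = (if \<exists>a\<in>A. d a v \<le> 2 then SOME a. a \<in> A \<and> d a v \<le> 2
    else SOME a. a \<in> A \<and> d a v \<le> 4)" for v
  have \<phi>: "\<phi> v \<in> A \<and> d (\<phi> v) v \<le> 4" if "v \<in> V" for v
  proof (cases "\<exists>a\<in>A. d a v \<le> 2")
    case True
    then have "\<phi> v \<in> A \<and> d (\<phi> v) v \<le> 2"
      unfolding \<phi>_def using someI_ex[of "\<lambda>a. a \<in> A \<and> d a v \<le> 2"] by auto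
    then show ?thesis by auto
  next
    case False
    then show ?thesis
      unfolding \<phi>_def using someI_ex[of "\<lambda>a. a \<in> A \<and> d a v \<le> 4"] dense[OF that] by auto
  qed
  have \<phi>_ball: "\<phi> v = a" if "a \<in> A" "v \<in> V" "d a v \<le> 2" for a v
  proof -
    have "\<phi> v \<in> A \<and> d (\<phi> v) v \<le> 2"
      unfolding \<phi>_def using someI_ex[of "\<lambda>a. a \<in> A \<and> d a v \<le> 2"] that by auto
    then have "d (\<phi> v) a \<le> 4" "\<phi> v \<in> A"
      using d_triangle[of "\<phi> v" v a] that A(1) d_sym[of a v] by fastforce+
    then show ?thesis using far[of "\<phi> v" a] that by force
  qed
  define c where "c a = real (card {v \<in> V. \<phi> v = a})" for a
  have c_ge: "card {x \<in> V. d a x \<le> 2} \<le> c a" if "a \<in> A" for a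
    unfolding c_def using \<phi>_ball[OF that] finite_carrier by (auto intro!: card_mono)
  define k where "k = real (card A)"
  have k1: "1 \<le> k" unfolding k_def using A(2) finA
    by (metis One_nat_def Suc_leI card_gt_0_iff empty_iff of_nat_1 of_nat_mono)
  have sum_c: "(\<Sum>a\<in>A. c a) = card V"
  proof -
    have "(\<Sum>a\<in>A. c a) = (\<Sum>a\<in>A. \<Sum>v | v \<in> V \<and> \<phi> v = a. 1)" by (simp add: c_def)
    also have "\<dots> = (\<Sum>v\<in>V. 1)" using finA finite_carrier \<phi> by (intro sum.group) auto
    finally show ?thesis by simp
  qed
  \<comment> \<open>Comparing guaranteed with actual weights bounds the packing size:
    \<open>k \<le> N\<close>.\<close>
  have "k * \<epsilon> + D = (\<Sum>a\<in>A. \<epsilon> + (if a = v\<^sub>1 then D else 0))"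
    using finA A(2) by (simp add: sum.distrib k_def)
  also have "\<dots> \<le> (\<Sum>a\<in>A. c a)"
  proof (rule sum_mono)
    fix a assume a: "a \<in> A"
    then have "a \<in> V" using A by blast
    then show "\<epsilon> + (if a = v\<^sub>1 then D else 0) \<le> c a"
      using ball[of a] ball1 c_ge[OF a] by auto
  qed
  finally have "k * \<epsilon> \<le> N * \<epsilon>" using sum_c N by simp
  then have kN: "k \<le> N" using \<open>0 < \<epsilon>\<close> by simp
  have bound: "ecc V v \<le> ecc A (\<phi> v) + 8" if v: "v \<in> V" for v
  proof (rule ecc_leI)
    fix s assume s: "s \<in> V"
    have m: "\<phi> v \<in> V" "\<phi> s \<in> V" using \<phi> s v A(1) by auto
    have "d v s \<le> d v (\<phi> v) + d (\<phi> v) s" using d_triangle v s m by blast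
    also have "d (\<phi> v) s \<le> d (\<phi> v) (\<phi> s) + d (\<phi> s) s" using d_triangle s m by blast
    also have "d (\<phi> v) (\<phi> s) \<le> ecc A (\<phi> v)" using d_le_ecc[OF A(1)] \<phi>[OF s] by blast
    finally show "d v s \<le> ecc A (\<phi> v) + 8" using \<phi>[OF v] \<phi>[OF s] d_sym[of v] by force
  qed (use that in auto)
  have "(\<Sum>v\<in>V. ecc V v) \<le> (\<Sum>v\<in>V. ecc A (\<phi> v) + 8)" by (rule sum_mono) (rule bound)
  also have "\<dots> = (\<Sum>v\<in>V. ecc A (\<phi> v)) + 8 * card V" by (simp add: sum.distrib)
  also have "(\<Sum>v\<in>V. ecc A (\<phi> v)) = (\<Sum>a\<in>A. \<Sum>v | v \<in> V \<and> \<phi> v = a. ecc A (\<phi> v))"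
    using finA finite_carrier \<phi> by (intro sum.group[symmetric]) auto
  also have "\<dots> = (\<Sum>a\<in>A. c a * ecc A a)" by (simp add: c_def)
  \<comment> \<open>Each weight splits into a base \<open>\<epsilon>\<close>, handled by the
    unweighted sum bound, and an excess, charged at the largest possible eccentricity
    \<open>5 * (k - 1)\<close>.\<close>
  also have "\<dots> = \<epsilon> * (\<Sum>a\<in>A. ecc A a) + (\<Sum>a\<in>A. (c a - \<epsilon>) * ecc A a)"
    by (simp add: sum_distrib_left sum.distrib[symmetric] algebra_simps)
  also have "(\<Sum>a\<in>A. (c a - \<epsilon>) * ecc A a) \<le> (\<Sum>a\<in>A. (c a - \<epsilon>) * (5 * (k - 1)))"
  proof (rule sum_mono, rule mult_left_mono)
    fix a assume a: "a \<in> A"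
    show "ecc A a \<le> 5 * (k - 1)" using ecc_le_card[OF A(1) _ A(3) a] by (simp add: k_def)
    show "0 \<le> c a - \<epsilon>" using ball[of a] c_ge[OF a] a A(1) by force
  qed
  also have "\<dots> = (N * \<epsilon> + D - k * \<epsilon>) * (5 * (k - 1))"
    by (simp add: sum_distrib_right[symmetric] sum_subtractf sum_c N k_def)
  also have "\<epsilon> * (\<Sum>a\<in>A. ecc A a) \<le> \<epsilon> * (5 * (3 * k\<^sup>2 - 2 * k) / 4)"
    using sum_ecc_le[OF A(1) _ A(3)] \<open>0 < \<epsilon>\<close> unfolding k_def by (intro mult_left_mono) auto
  finally have main: "(\<Sum>v\<in>V. ecc V v) \<le>
    \<epsilon> * (5 * (3 * k\<^sup>2 - 2 * k) / 4) + (N * \<epsilon> + D - k * \<epsilon>) * (5 * (k - 1)) + 8 * card V" by simp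
  \<comment> \<open>This removes the unknown \<open>k\<close>: the difference of the two sides is a
    product of nonnegative factors plus \<open>N - k / 2\<close>, which is positive since
    \<open>0 < k \<le> N\<close>.\<close>
  have "(3 * k\<^sup>2 - 2 * k) / 4 + (N - k) * (k - 1) \<le> 3 * N\<^sup>2 / 4"
  proof -
    have "3 * N\<^sup>2 / 4 - ((3 * k\<^sup>2 - 2 * k) / 4 + (N - k) * (k - 1))
      = (N - k) * (3 * N - k) / 4 + N - k / 2"
      by (simp add: power2_eq_square field_simps)
    moreover have "0 \<le> (N - k) * (3 * N - k)" using kN k1 by (intro mult_nonneg_nonneg) auto
    ultimately show ?thesis using kN k1 by linarith
  qed
  then have "5 * \<epsilon> * ((3 * k\<^sup>2 - 2 * k) / 4 + (N - k) * (k - 1)) \<le> 5 * \<epsilon> * (3 * N\<^sup>2 / 4)"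
    using \<open>0 < \<epsilon>\<close> by (intro mult_left_mono) auto
  moreover have "5 * D * (k - 1) \<le> 5 * D * N"
    using kN \<open>0 \<le> D\<close> by (intro mult_left_mono) auto
  \<comment> \<open>Substituting \<open>N * \<epsilon> + D\<close> for \<open>card V\<close> in the
    leading term yields \<open>15 / 4 * N * D\<close>; the extra \<open>5 / 4 * N * D\<close>
    completes it to \<open>5 * D * N\<close>, the cost of the surplus.\<close>
  moreover have "card V * (15 / 4 * N + 37 / 4) + 5 / 4 * N * D
    = 5 * \<epsilon> * (3 * N\<^sup>2 / 4) + 5 * D * N + 37 / 4 * card V"
    unfolding N by (simp add: power2_eq_square field_simps)
  moreover have "\<epsilon> * (5 * (3 * k\<^sup>2 - 2 * k) / 4) + (N * \<epsilon> + D - k * \<epsilon>) * (5 * (k - 1))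
    = 5 * \<epsilon> * ((3 * k\<^sup>2 - 2 * k) / 4 + (N - k) * (k - 1)) + 5 * D * (k - 1)"
    by (simp add: power2_eq_square field_simps)
  ultimately show ?thesis using main by linarith
qed

end

section \<open>Distance-two balls in C4-free graphs\<close>

lemma even_card_involution:
  assumes "finite X" "\<And>x. x \<in> X \<Longrightarrow> f x \<in> X \<and> f x \<noteq> x \<and> f (f x) = x"
  shows "even (card X)"
  using assms
proof (induction "card X" arbitrary: X rule: less_induct)
  case less
  show ?case
  proof (cases "X = {}")
    case False
    then obtain x where x: "x \<in> X" by blast
    let ?Y = "X - {x, f x}"
    have fx: "f x \<in> X" "f x \<noteq> x" using less.prems(2) x by auto
    have "card X = card ?Y + 2"
    proof -
      have "X = insert x (insert (f x) ?Y)" using x fx by blast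
      then have "card X = card (insert x (insert (f x) ?Y))" by simp
      then show ?thesis using fx less.prems(1) by simp
    qed
    moreover have "even (card ?Y)"
    proof (rule less.hyps)
      show "card ?Y < card X" using \<open>card X = card ?Y + 2\<close> by simp
      show "f y \<in> ?Y \<and> f y \<noteq> y \<and> f (f y) = y" if "y \<in> ?Y" for y
        using that less.prems(2) x by (metis Diff_iff insertCI insertE singletonD)
    qed (use less.prems in auto)
    ultimately show ?thesis by simp
  qed simp
qed

context graph
begin

definition nbrs :: "'a \<Rightarrow> 'a set" where
  "nbrs v = {w. (v, w) \<in> arcs_ends G}"

lemma nbrs_sym: "w \<in> nbrs v \<Longrightarrow> v \<in> nbrs w"
  by (simp add: nbrs_def graph_symmetric)

lemma nbrs_irrefl: "v \<notin> nbrs v"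
  using no_loops by (auto simp: nbrs_def arcs_ends_def arc_to_ends_def)

lemma nbrs_subset: "nbrs v \<subseteq> verts G"
  by (auto simp: nbrs_def)

lemma finite_nbrs: "finite (nbrs v)"
  using nbrs_subset finite_subset finite_verts by blast

lemma card_nbrs: "card (nbrs v) = out_degree G v"
proof -
  have "nbrs v = head G ` out_arcs G v"
    by (auto simp: nbrs_def arcs_ends_def arc_to_ends_def image_iff)
  moreover have "inj_on (head G) (out_arcs G v)"
    by (rule inj_onI) (auto intro!: no_multi_arcs simp: arc_to_ends_def)
  ultimately show ?thesis by (simp add: out_degree_def card_image)
qed

lemma C4_free_nbrs:
  assumes "C4_free G" "b \<in> nbrs a" "b \<in> nbrs c" "b' \<in> nbrs a" "b' \<in> nbrs c" "a \<noteq> c"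
  shows "b = b'"
proof (rule ccontr)
  assume "b \<noteq> b'"
  have *: "\<exists>e\<in>arcs G. tail G e = x \<and> head G e = y" if "y \<in> nbrs x" for x y
    using that by (auto simp: nbrs_def arcs_ends_def arc_to_ends_def)
  have "c \<in> nbrs b" "a \<in> nbrs b'" using assms nbrs_sym by auto
  obtain e1 e2 e3 e4 where e: "e1 \<in> arcs G" "tail G e1 = a" "head G e1 = b"
     "e2 \<in> arcs G" "tail G e2 = b" "head G e2 = c"
     "e3 \<in> arcs G" "tail G e3 = c" "head G e3 = b'"
     "e4 \<in> arcs G" "tail G e4 = b'" "head G e4 = a"
    using *[OF assms(2)] *[OF \<open>c \<in> nbrs b\<close>] *[OF assms(5)] *[OF \<open>a \<in> nbrs b'\<close>] by blast
  have "a \<noteq> b" "a \<noteq> b'" "c \<noteq> b" "c \<noteq> b'" using assms nbrs_irrefl by auto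
  \<comment> \<open>Two common neighbours \<open>b\<close>, \<open>b'\<close> of \<open>a\<close>
    and \<open>c\<close> close the 4-cycle through \<open>a\<close>, \<open>b\<close>,
    \<open>c\<close>, \<open>b'\<close>.\<close>
  then have "cycle [e1, e2, e3, e4]"
    unfolding cycle_def awalk_def using e assms(6) \<open>b \<noteq> b'\<close>
    by (intro exI[of _ a]) auto
  then show False using assms(1) unfolding C4_free_def by force
qed

text \<open>Each neighbour \<open>w\<close> of \<open>v\<close> contributes a set \<open>S w\<close>
  of vertices outside \<open>v\<close> and its neighbourhood, and these sets are disjoint. At most
  \<open>v\<close> and one further neighbour of \<open>v\<close> are lost from
  \<open>nbrs w\<close>. The neighbours of \<open>v\<close> that lose one are matched in pairs by
  \<open>f\<close>, so their number is even; hence the rounded term, kept on the right to avoid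
  natural-number subtraction.\<close>

lemma ball_two_card:
  assumes "C4_free G" "\<And>w. w \<in> verts G \<Longrightarrow> \<delta> \<le> out_degree G w"
  shows "out_degree G v * \<delta> + 1 \<le>
    card (insert v (nbrs v \<union> (\<Union>w\<in>nbrs v. nbrs w))) + 2 * (out_degree G v div 2)"
proof -
  let ?N = "nbrs v"
  let ?dg = "card ?N"
  define S where "S w = nbrs w - insert v ?N" for w
  define M where "M = {w \<in> ?N. nbrs w \<inter> ?N \<noteq> {}}"
  define f where "f w = (THE u. u \<in> nbrs w \<inter> ?N)" for w
  \<comment> \<open>Such \<open>u\<close> and \<open>u'\<close> would be common neighbours of
    \<open>w\<close> and \<open>v\<close>.\<close>
  have uniq: "u = u'" if "w \<in> ?N" "u \<in> nbrs w \<inter> ?N" "u' \<in> nbrs w \<inter> ?N" for w u u'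
    using C4_free_nbrs[OF assms(1), of u w v u'] that nbrs_irrefl[of v] by auto
  have f: "nbrs w \<inter> ?N = {f w}" if "w \<in> M" for w
  proof -
    obtain u where u: "u \<in> nbrs w \<inter> ?N" "w \<in> ?N" using \<open>w \<in> M\<close> M_def by auto
    then have "f w = u" unfolding f_def using uniq by (intro the_equality) blast+
    then show ?thesis using u uniq by blast
  qed
  have finM: "finite M" unfolding M_def using finite_nbrs by simp
  have "even (card M)"
  proof (rule even_card_involution[where f = f])
    fix w assume w: "w \<in> M"
    have fw: "f w \<in> nbrs w" "f w \<in> ?N" using f[OF w] by auto
    have ww: "w \<in> nbrs (f w) \<inter> ?N" using fw nbrs_sym w M_def by blast
    then have fM: "f w \<in> M" unfolding M_def using fw by auto
    have "w = f (f w)" using ww unfolding f[OF fM] by simp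
    moreover have "f w \<noteq> w" using fw(1) nbrs_irrefl[of w] by metis
    ultimately show "f w \<in> M \<and> f w \<noteq> w \<and> f (f w) = w" using fM by simp
  qed (rule finM)
  moreover have "card M \<le> ?dg" by (rule card_mono) (auto simp: M_def finite_nbrs)
  ultimately have cM: "card M \<le> 2 * (?dg div 2)" by presburger
  have S_card: "\<delta> \<le> card (S w) + 1 + card (nbrs w \<inter> ?N)" if "w \<in> ?N" for w
  proof -
    have "nbrs w \<subseteq> S w \<union> {v} \<union> (nbrs w \<inter> ?N)" by (auto simp: S_def)
    then have "card (nbrs w) \<le> card (S w \<union> {v} \<union> (nbrs w \<inter> ?N))"
      by (rule card_mono[rotated]) (auto simp: S_def finite_nbrs)
    also have "\<dots> \<le> card (S w \<union> {v}) + card (nbrs w \<inter> ?N)" by (rule card_Un_le)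
    also have "card (S w \<union> {v}) \<le> card (S w) + 1" using card_Un_le[of "S w" "{v}"] by simp
    finally show ?thesis using assms(2)[of w] that nbrs_subset[of v] by (auto simp: card_nbrs)
  qed
  have "(\<Sum>w\<in>?N. card (nbrs w \<inter> ?N)) = (\<Sum>w\<in>M. card (nbrs w \<inter> ?N))"
    by (rule sum.mono_neutral_right) (auto simp: M_def finite_nbrs)
  also have "\<dots> = card M" using f by simp
  finally have sumM: "(\<Sum>w\<in>?N. card (nbrs w \<inter> ?N)) = card M" .
  have disj: "S w \<inter> S w' = {}" if "w \<in> ?N" "w' \<in> ?N" "w \<noteq> w'" for w w'
  proof (rule ccontr)
    assume "S w \<inter> S w' \<noteq> {}"
    then obtain x where x: "x \<in> nbrs w" "x \<in> nbrs w'" "x \<noteq> v" by (auto simp: S_def)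
    \<comment> \<open>Here \<open>w\<close> and \<open>w'\<close> are common neighbours of
      \<open>v\<close> and \<open>x\<close>.\<close>
    have "w = w'"
      using C4_free_nbrs[OF assms(1), of w v x w'] x that(1,2) nbrs_sym by metis
    then show False using that by simp
  qed
  have union: "card (\<Union>w\<in>?N. S w) = (\<Sum>w\<in>?N. card (S w))"
    by (rule card_UN_disjoint) (use disj finite_nbrs in \<open>auto simp: S_def\<close>)
  have "?dg * \<delta> = (\<Sum>w\<in>?N. \<delta>)" by simp
  also have "\<dots> \<le> (\<Sum>w\<in>?N. card (S w) + 1 + card (nbrs w \<inter> ?N))"
    by (rule sum_mono) (rule S_card)
  also have "\<dots> = card (\<Union>w\<in>?N. S w) + ?dg + card M"
    by (simp only: sum.distrib union sumM) simp
  finally have "?dg * \<delta> + 1 \<le> card (\<Union>w\<in>?N. S w) + (?dg + 1) + 2 * (?dg div 2)"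
    using cM by linarith
  also have "?dg + 1 = card (insert v ?N)" using nbrs_irrefl finite_nbrs by simp
  also have "card (\<Union>w\<in>?N. S w) + card (insert v ?N) = card ((\<Union>w\<in>?N. S w) \<union> insert v ?N)"
    by (rule card_Un_disjoint[symmetric]) (auto simp: S_def finite_nbrs)
  also have "(\<Union>w\<in>?N. S w) \<union> insert v ?N = insert v (?N \<union> (\<Union>w\<in>?N. nbrs w))"
    by (auto simp: S_def)
  finally show ?thesis by (simp add: card_nbrs)
qed

section \<open>Graph distance as a pseudometric\<close>

lemma ex_shortest_awalk:
  assumes "u \<rightarrow>\<^sup>* v"
  shows "\<exists>p. awalk u p v \<and> graph_dist G u v = length p \<and> (\<forall>q. awalk u q v \<longrightarrow> length p \<le> length q)"
  by (rule graph_dist_eq_length[OF assms]) (auto simp: apath_def)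

lemma graph_dist_le_length:
  assumes "awalk u p v"
  shows "graph_dist G u v \<le> length p"
proof -
  have "u \<rightarrow>\<^sup>* v" unfolding reachable_awalk using assms by (rule exI)
  from ex_shortest_awalk[OF this] show ?thesis using assms by auto
qed

lemma ex_reversed_awalk:
  assumes "awalk u p v"
  shows "\<exists>q. awalk v q u \<and> length q = length p"
  using assms
proof (induction p arbitrary: u)
  case Nil
  then show ?case by (auto simp: awalk_Nil_iff intro!: exI[of _ "[]"])
next
  case (Cons e p)
  then obtain q where q: "awalk v q (head G e)" "length q = length p" by (auto simp: awalk_Cons_iff)
  have e: "e \<in> arcs G" "tail G e = u" using Cons.prems by (auto simp: awalk_Cons_iff)
  then have "(head G e, u) \<in> arcs_ends G"
    using graph_symmetric by (auto simp: arcs_ends_def arc_to_ends_def)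
  then obtain e' where "e' \<in> arcs G" "tail G e' = head G e" "head G e' = u"
    by (auto simp: arcs_ends_def arc_to_ends_def)
  then have "awalk (head G e) [e'] u" using arc_implies_awalk by metis
  with q(1) have "awalk v (q @ [e']) u" by (rule awalk_appendI)
  then show ?case using q by (intro exI[of _ "q @ [e']"]) simp
qed

lemma reachable_if_connected:
  "Digraph_Component.connected G \<Longrightarrow> u \<in> verts G \<Longrightarrow> v \<in> verts G \<Longrightarrow> u \<rightarrow>\<^sup>* v"
  using symmetric_connected_imp_strongly_connected sym_arcs by auto

lemma finite_pseudometric_graph_dist:
  assumes "Digraph_Component.connected G"
  shows "finite_pseudometric (verts G) (graph_dist G)"
proof
  show "finite (verts G)" by simp
next
  fix u assume "u \<in> verts G"
  then have u: "awalk u [] u" "u \<rightarrow>\<^sup>* u" by (auto simp: awalk_Nil_iff)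
  show "graph_dist G u u = 0"
    using ex_shortest_awalk[OF u(2)] graph_dist_le_length[OF u(1)] by auto
next
  fix u v w assume uvw: "u \<in> verts G" "v \<in> verts G" "w \<in> verts G"
  obtain p where p: "awalk u p v" "graph_dist G u v = length p"
    using ex_shortest_awalk[OF reachable_if_connected[OF assms uvw(1,2)]] by auto
  obtain q where q: "awalk v q w" "graph_dist G v w = length q"
    using ex_shortest_awalk[OF reachable_if_connected[OF assms uvw(2,3)]] by auto
  have "awalk u (p @ q) w" using p(1) q(1) by (rule awalk_appendI)
  then show "graph_dist G u w \<le> graph_dist G u v + graph_dist G v w"
    using graph_dist_le_length[of u "p @ q" w] p(2) q(2) by simp
next
  have le: "graph_dist G v u \<le> graph_dist G u v" if uv: "u \<rightarrow>\<^sup>* v" for u v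
  proof -
    obtain p where p: "awalk u p v" "graph_dist G u v = length p"
      using ex_shortest_awalk[OF uv] by auto
    then obtain q where "awalk v q u" "length q = length p"
      using ex_reversed_awalk[of u p v] by auto
    then show ?thesis using graph_dist_le_length[of v q u] p(2) by simp
  qed
  fix u v
  show "graph_dist G u v = graph_dist G v u"
  proof (cases "u \<rightarrow>\<^sup>* v")
    case True
    then show ?thesis using le[of u v] le[of v u] symmetric_reachable'[of u v] by simp
  next
    \<comment> \<open>Symmetry is required of all pairs, even outside the graph. Without a walk both
      costs are infinite, and both distances take the default value 0.\<close>
    case False
    then have "\<not> v \<rightarrow>\<^sup>* u" using symmetric_reachable'[of v u] by blast
    then show ?thesis using False by (simp add: graph_dist_def shortest_path_inf)
  qed
qed

lemma graph_dist_nbrs: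
  assumes "w \<in> nbrs v"
  shows "graph_dist G v w \<le> 1"
proof -
  obtain e where "e \<in> arcs G" "tail G e = v" "head G e = w"
    using assms by (auto simp: nbrs_def arcs_ends_def arc_to_ends_def)
  then have "awalk v [e] w" using arc_implies_awalk by metis
  then show ?thesis using graph_dist_le_length[of v "[e]" w] by simp
qed

lemma cut_connected_nbrs:
  assumes "Digraph_Component.connected G"
  shows "cut_connected (\<lambda>x y. y \<in> nbrs x) (verts G)"
  unfolding cut_connected_def
proof (intro allI impI)
  fix T assume T: "T \<subseteq> verts G" "T \<noteq> {}" "T \<noteq> verts G"
  then obtain u v where u: "u \<in> T" and v: "v \<in> verts G - T" by blast
  have "u \<rightarrow>\<^sup>* v" using reachable_if_connected[OF assms] u v T by blast
  \<comment> \<open>Induction along a walk from \<open>u\<close>: either the vertex reached is still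
    in \<open>T\<close>, or an edge leaving \<open>T\<close> has been met.\<close>
  then have "v \<in> T \<or> (\<exists>t\<in>T. \<exists>s\<in>verts G - T. s \<in> nbrs t)"
  proof (induction rule: reachable_induct)
    case base
    show ?case using u by simp
  next
    case (step x y)
    then have "y \<in> verts G" "y \<in> nbrs x" by (auto simp: nbrs_def)
    then show ?case using step.IH by blast
  qed
  then show "\<exists>t\<in>T. \<exists>s\<in>verts G - T. s \<in> nbrs t" using v by blast
qed

lemma ball_two_subset:
  assumes "Digraph_Component.connected G" "v \<in> verts G"
  shows "insert v (nbrs v \<union> (\<Union>w\<in>nbrs v. nbrs w)) \<subseteq> {x \<in> verts G. graph_dist G v x \<le> 2}"
proof -
  interpret finite_pseudometric "verts G" "graph_dist G"
    by (rule finite_pseudometric_graph_dist[OF assms(1)])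
  have "graph_dist G v x \<le> 2" if "w \<in> nbrs v" "x \<in> nbrs w" for w x
  proof -
    have "w \<in> verts G" "x \<in> verts G" using that nbrs_subset by blast+
    then show ?thesis
      using d_triangle[of v w x] graph_dist_nbrs[OF that(1)] graph_dist_nbrs[OF that(2)] assms(2)
      by simp
  qed
  moreover have "graph_dist G v w \<le> 2" if "w \<in> nbrs v" for w
    using graph_dist_nbrs[OF that] by simp
  ultimately show ?thesis using assms(2) subsetD[OF nbrs_subset] d_self[of v] by auto
qed

end

section \<open>The bound in terms of minimum and maximum degree\<close>

theorem theorem3:
  fixes G :: "('a, 'b) pre_digraph"
    and n \<delta> \<Delta> :: nat
    and \<epsilon>\<^sub>\<Delta> \<epsilon>\<^sub>\<delta> :: real
  assumes "graph G"
    and "Digraph_Component.connected G"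
    and "C4_free G"
    and "n = card (verts G)"
    and "\<delta> = min_degree G"
    and "\<Delta> = max_degree G"
    and "\<epsilon>\<^sub>\<Delta> = real \<Delta> * real \<delta> - 2 * of_int \<lfloor>real \<Delta> / 2\<rfloor> + 1"
    and "\<epsilon>\<^sub>\<delta> = (real \<delta>)\<^sup>2 - 2 * of_int \<lfloor>real \<delta> / 2\<rfloor> + 1"
  shows "avec G \<le> 15 / 4 * ((real n - \<epsilon>\<^sub>\<Delta> + \<epsilon>\<^sub>\<delta>) / \<epsilon>\<^sub>\<delta>) * (1 + (\<epsilon>\<^sub>\<Delta> - \<epsilon>\<^sub>\<delta>) / (3 * real n)) + 37 / 4"
proof -
  interpret graph G by fact
  interpret P: finite_pseudometric "verts G" "graph_dist G"
    by (rule finite_pseudometric_graph_dist[OF assms(2)])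
  have conn: "cut_connected (\<lambda>x y. graph_dist G x y \<le> 1) (verts G)"
    by (rule cut_connected_mono[OF cut_connected_nbrs[OF assms(2)] graph_dist_nbrs])
  have ne: "verts G \<noteq> {}"
    using assms(2) unfolding connected_conv by (rule conjunct1)
  then have n1: "1 \<le> n" using assms(4) by (simp add: Suc_leI card_gt_0_iff)
  have ecc: "eccentricity G v = P.ecc (verts G) v" for v
    by (simp add: eccentricity_def P.ecc_def)
  have avec: "avec G = (\<Sum>v\<in>verts G. P.ecc (verts G) v) / n"
    by (simp add: avec_def ecc assms(4))
  have \<delta>: "\<delta> \<le> out_degree G v" if "v \<in> verts G" for v
    using that by (auto simp: assms(5) min_degree_def)
  have "max_degree G \<in> out_degree G ` verts G"
    unfolding max_degree_def using ne by (intro Max_in) auto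
  then obtain v\<^sub>1 where v1: "v\<^sub>1 \<in> verts G" "out_degree G v\<^sub>1 = \<Delta>" using assms(6) by auto
  have fl: "of_int \<lfloor>real m / 2\<rfloor> = real (m div 2)" for m
    using floor_divide_of_nat_eq[of m 2, where ?'a = real] by simp
  \<comment> \<open>One function of the degree covers both constants of the theorem and the ball
    bound at every vertex.\<close>
  define \<eta> where "\<eta> m = real m * real \<delta> - 2 * real (m div 2) + 1" for m
  have eta: "\<epsilon>\<^sub>\<Delta> = \<eta> \<Delta>" "\<epsilon>\<^sub>\<delta> = \<eta> \<delta>"
    unfolding assms(7,8) fl \<eta>_def by (simp_all add: power2_eq_square)
  have ball: "\<eta> (out_degree G v) \<le> card {x \<in> verts G. graph_dist G v x \<le> 2}" if "v \<in> verts G" for v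
  proof -
    let ?B = "insert v (nbrs v \<union> (\<Union>w\<in>nbrs v. nbrs w))"
    have "out_degree G v * \<delta> + 1 \<le> card ?B + 2 * (out_degree G v div 2)"
      by (rule ball_two_card[OF assms(3) \<delta>])
    then have "real (out_degree G v * \<delta> + 1) \<le> real (card ?B + 2 * (out_degree G v div 2))"
      by (simp only: of_nat_le_iff)
    then have "\<eta> (out_degree G v) \<le> card ?B" by (simp add: \<eta>_def)
    also have "\<dots> \<le> card {x \<in> verts G. graph_dist G v x \<le> 2}"
      using card_mono[OF _ ball_two_subset[OF assms(2) that]] by simp
    finally show ?thesis .
  qed
  have \<delta>\<Delta>: "\<delta> \<le> \<Delta>" using \<delta>[OF v1(1)] v1(2) by simp
  show ?thesis
  proof (cases "2 \<le> \<delta>")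
    case True
    \<comment> \<open>Raising the degree from \<open>\<delta>\<close> by \<open>j\<close> adds
      \<open>j * \<delta>\<close>, at least \<open>2 * j\<close>, while the subtracted rounding term
      grows by at most \<open>2 * j\<close>. So \<open>\<epsilon>\<^sub>\<delta>\<close> is valid at
      every vertex and the surplus \<open>D\<close> is nonnegative.\<close>
    have mono: "\<eta> \<delta> \<le> \<eta> m" if "\<delta> \<le> m" for m
    proof -
      have "m div 2 + \<delta> \<le> m + \<delta> div 2" using that by presburger
      then have "real (m div 2 + \<delta>) \<le> real (m + \<delta> div 2)" by (simp only: of_nat_le_iff)
      then have "2 * (real (m div 2) - real (\<delta> div 2)) \<le> 2 * (real m - real \<delta>)"
        by simp
      also have "\<dots> \<le> real \<delta> * (real m - real \<delta>)" using True that by (intro mult_right_mono) auto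
      finally show ?thesis by (simp add: \<eta>_def algebra_simps)
    qed
    have "2 * real (\<delta> div 2) \<le> real \<delta> * 1" by linarith
    also have "\<dots> \<le> real \<delta> * real \<delta>" using True by (intro mult_left_mono) auto
    finally have pos: "0 < \<eta> \<delta>" by (simp add: \<eta>_def)
    define D where "D = \<epsilon>\<^sub>\<Delta> - \<epsilon>\<^sub>\<delta>"
    define N where "N = (real n - \<epsilon>\<^sub>\<Delta> + \<epsilon>\<^sub>\<delta>) / \<epsilon>\<^sub>\<delta>"
    have "real (card (verts G)) = N * \<eta> \<delta> + D"
      using pos by (simp add: N_def D_def eta assms(4))
    moreover have "\<eta> \<delta> \<le> card {x \<in> verts G. graph_dist G v x \<le> 2}" if "v \<in> verts G" for v
      using ball[OF that] mono[OF \<delta>[OF that]] by linarith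
    moreover have "\<eta> \<delta> + D \<le> card {x \<in> verts G. graph_dist G v\<^sub>1 x \<le> 2}"
      using ball[OF v1(1)] v1(2) by (simp add: D_def eta)
    moreover have "0 \<le> D" using mono[OF \<delta>\<Delta>] by (simp add: D_def eta)
    ultimately have "(\<Sum>v\<in>verts G. P.ecc (verts G) v) \<le> n * (15 / 4 * N + 37 / 4) + 5 / 4 * N * D"
      using P.sum_ecc_le_ball[OF conn v1(1) pos] assms(4) by blast
    then have "avec G \<le> (n * (15 / 4 * N + 37 / 4) + 5 / 4 * N * D) / n"
      unfolding avec by (intro divide_right_mono) auto
    also have "\<dots> = 15 / 4 * N * (1 + D / (3 * real n)) + 37 / 4"
      using n1 by (simp add: field_simps)
    finally show ?thesis by (simp add: N_def D_def)
  next
    case False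
    have le: "P.ecc (verts G) v \<le> n - 1" if "v \<in> verts G" for v
      using P.ecc_le_card[OF subset_refl _ conn that] n1 assms(4) by simp
    have "(\<Sum>v\<in>verts G. P.ecc (verts G) v) \<le> n * (real n - 1)"
      using sum_bounded_above[of "verts G", OF le] assms(4) n1 by (simp add: of_nat_diff)
    then have av: "avec G \<le> real n - 1" unfolding avec using n1 by (simp add: field_simps)
    \<comment> \<open>Here \<open>\<epsilon>\<^sub>\<Delta> < \<epsilon>\<^sub>\<delta>\<close> may occur, but \<open>avec G \<le> n - 1\<close> suffices.\<close>
    consider "\<delta> = 0" | "\<delta> = 1" using False by linarith
    then show ?thesis
    proof cases
      case 1
      have "min_degree G \<in> out_degree G ` verts G"
        unfolding min_degree_def using ne by (intro Min_in) auto
      then obtain v where v: "v \<in> verts G" "nbrs v = {}"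
        using assms(5) 1 card_nbrs finite_nbrs by (metis card_0_eq imageE)
      \<comment> \<open>No edge leaves the isolated vertex \<open>v\<close>, so connectedness leaves
        no other vertex.\<close>
      have "verts G = {v}"
        using cut_connectedD[OF cut_connected_nbrs[OF assms(2)], of "{v}"] v by blast
      then have "n = 1" "\<Delta> = 0" using assms(4) v v1 card_nbrs[of v] by auto
      then show ?thesis using av 1 by (simp add: eta \<eta>_def)
    next
      case 2
      have \<epsilon>\<delta>: "\<epsilon>\<^sub>\<delta> = 2" by (simp add: eta \<eta>_def 2)
      \<comment> \<open>For \<open>\<delta> = 1\<close> the value is one more than the parity of
        \<open>\<Delta>\<close>.\<close>
      have \<epsilon>\<Delta>: "\<epsilon>\<^sub>\<Delta> = 1 \<or> \<epsilon>\<^sub>\<Delta> = 2"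
      proof -
        have "\<Delta> = 2 * (\<Delta> div 2) \<or> \<Delta> = 2 * (\<Delta> div 2) + 1" by presburger
        then have "real \<Delta> = 2 * real (\<Delta> div 2) \<or> real \<Delta> = 2 * real (\<Delta> div 2) + 1" by linarith
        then show ?thesis by (auto simp: eta \<eta>_def 2)
      qed
      \<comment> \<open>The quotient is at least \<open>n / 2\<close> and the bracket at least
        \<open>1 - 1 / (3 * n)\<close>, hence at least \<open>2 / 3\<close>. The product
        \<open>5 / 4 * n\<close> exceeds \<open>n - 1\<close>.\<close>
      have "15 / 4 * (real n / 2) * (2 / 3)
        \<le> 15 / 4 * ((real n - \<epsilon>\<^sub>\<Delta> + \<epsilon>\<^sub>\<delta>) / \<epsilon>\<^sub>\<delta>) * (1 + (\<epsilon>\<^sub>\<Delta> - \<epsilon>\<^sub>\<delta>) / (3 * real n))"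
      proof (rule mult_mono)
        show "2 / 3 \<le> 1 + (\<epsilon>\<^sub>\<Delta> - \<epsilon>\<^sub>\<delta>) / (3 * real n)"
          using \<epsilon>\<Delta> \<epsilon>\<delta> n1 by (auto simp: field_simps)
      qed (use \<epsilon>\<Delta> \<epsilon>\<delta> in auto)
      then show ?thesis using av by linarith
    qed
  qed
qed

end
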